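(* For any NFA $\mathcal{A}$ and any small enough $\varepsilon>0$, there exists an $\varepsilon$-tester for $L(\mathcal{A})$ that uses $\mathcal{O}(\varepsilon^{-1}\log(\varepsilon^{-1}))$ queries, where the hidden constant depends only on $\mathcal{A}$.
   Context: For words $u,v$, $d(u,v)$ is the Hamming distance (number of differing positions) if $|u|=|v|$ and $+\infty$ otherwise; $u$ of length $n$ is $\varepsilon$-far from $L$ if $d(u,v)\ge\varepsilon n$ for all $v\in L$. An $\varepsilon$-tester for $L$ is a randomized algorithm with query access to the letters of the input $u$ (of known length $n$) that always accepts if $u\in L$ and rejects with probability at least $2/3$ if $u$ is $\varepsilon$-far from $L$; queries are counted in the worst case over inputs and random choices.
   Formalization: The tester must reject ε-far words only when they are not in L; this matters only for the empty word, which by the literal definition is ε-far from every language, even one that contains it, so that no tester could exist for such a language. *)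

theory Defs
  imports "HOL-Probability.Probability" "HOL-Library.Extended_Real"
begin

record ('q, 'a) nfa =
  alphabet :: "'a set"
  states :: "'q set"
  transitions :: "('q \<times> 'a \<times> 'q) set"
  initials :: "'q set"
  finals :: "'q set"

definition is_nfa :: "('q, 'a) nfa \<Rightarrow> bool" where
  "is_nfa A \<longleftrightarrow>
     finite (alphabet A) \<and> finite (states A) \<and>
     transitions A \<subseteq> states A \<times> alphabet A \<times> states A \<and>
     initials A \<subseteq> states A \<and> finals A \<subseteq> states A"

inductive nfa_run :: "('q, 'a) nfa \<Rightarrow> 'q \<Rightarrow> 'a list \<Rightarrow> 'q \<Rightarrow> bool" for A where
  Nil: "nfa_run A p [] p"
| Cons: "(p, a, q) \<in> transitions A \<Longrightarrow> nfa_run A q w r \<Longrightarrow> nfa_run A p (a # w) r"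

definition nfa_lang :: "('q, 'a) nfa \<Rightarrow> 'a list set" where
  "nfa_lang A = {w. \<exists>p \<in> initials A. \<exists>q \<in> finals A. nfa_run A p w q}"

definition hamming_dist :: "'a list \<Rightarrow> 'a list \<Rightarrow> ereal" where
  "hamming_dist u v =
     (if length u = length v
      then ereal (real (card {i. i < length u \<and> u ! i \<noteq> v ! i}))
      else \<infinity>)"

definition far_from :: "real \<Rightarrow> 'a list set \<Rightarrow> 'a list \<Rightarrow> bool" where
  "far_from \<epsilon> L u \<longleftrightarrow> (\<forall>v \<in> L. hamming_dist u v \<ge> ereal (\<epsilon> * real (length u)))"

text \<open>
  A deterministic (adaptive) query algorithm on words of a fixed length is a decision tree:
  it either halts with a verdict (\<^const>\<open>True\<close> for acceptance) or queries a position (counted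
  from 0) and continues depending on the letter found there.
\<close>

datatype 'a query_alg =
  Halt bool
| Query nat "'a \<Rightarrow> 'a query_alg"

primrec accepts :: "'a query_alg \<Rightarrow> 'a list \<Rightarrow> bool" where
  "accepts (Halt b) u = b"
| "accepts (Query i k) u = accepts (k (u ! i)) u"

primrec queries :: "'a query_alg \<Rightarrow> 'a list \<Rightarrow> nat list" where
  "queries (Halt b) u = []"
| "queries (Query i k) u = i # queries (k (u ! i)) u"

text \<open>
  A randomized algorithm that knows the length \<open>n\<close> of its input draws all its random choices
  first and then runs the resulting deterministic algorithm. It is thus a family, indexed by \<open>n\<close>,
  of probability distributions on deterministic algorithms. A statement about all elements of the
  support is a statement about all random choices.
\<close>

type_synonym 'a rand_alg = "nat \<Rightarrow> 'a query_alg pmf"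

text \<open>
  The condition \<open>u \<notin> L\<close> in the rejection clause follows from \<open>far_from \<epsilon> L u\<close> for nonempty \<open>u\<close>
  and \<open>\<epsilon> > 0\<close>. It only matters for the empty word, which is at distance at least \<open>\<epsilon> \<cdot> 0\<close> from
  every language, including those that contain it: there, the acceptance clause takes precedence.
\<close>

definition is_tester :: "real \<Rightarrow> 'a set \<Rightarrow> 'a list set \<Rightarrow> 'a rand_alg \<Rightarrow> bool" where
  "is_tester \<epsilon> \<Sigma> L T \<longleftrightarrow>
     (\<forall>u \<in> lists \<Sigma>.
        (\<forall>t \<in> set_pmf (T (length u)). set (queries t u) \<subseteq> {..<length u}) \<and>
        (u \<in> L \<longrightarrow> (\<forall>t \<in> set_pmf (T (length u)). accepts t u)) \<and>
        (u \<notin> L \<and> far_from \<epsilon> L u \<longrightarrow>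
           measure_pmf.prob (T (length u)) {t. \<not> accepts t u} \<ge> 2 / 3))"

definition query_bound :: "'a set \<Rightarrow> 'a rand_alg \<Rightarrow> real \<Rightarrow> bool" where
  "query_bound \<Sigma> T b \<longleftrightarrow>
     (\<forall>u \<in> lists \<Sigma>. \<forall>t \<in> set_pmf (T (length u)). real (length (queries t u)) \<le> b)"

end

theory Submission
  imports Defs "HOL-Number_Theory.Cong"
begin

text \<open>
  Path lengths between two states are eventually periodic with a period \<open>m\<close>, so only positions
  modulo \<open>m\<close> matter, and a strongly connected component (of states paired with times) can be
  traversed between any two compatible points within a constant number \<open>B\<close> of letters. An interval
  of the input is blocking for a component if no run can read it while staying inside the component.
  Correcting the input greedily shows that a far input of length \<open>n\<close> has, for every component,
  \<open>\<Omega>(\<epsilon>n)\<close> disjoint blocking intervals, arranged so that knowing one of them per component excludes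
  every accepting run. Random windows of radius \<open>M div (j + 1)\<close> for \<open>j < M = O(1/\<epsilon>)\<close> contain such
  intervals with high probability whatever their lengths are, and the harmonic sum of the radii
  gives \<open>O(M ln M)\<close> queries.
\<close>

section \<open>Runs and lengths of paths\<close>

lemma nfa_run_Nil_iff: "nfa_run A p [] r \<longleftrightarrow> p = r"
  by (auto intro: nfa_run.Nil elim: nfa_run.cases)

lemma nfa_run_Cons_iff:
  "nfa_run A p (a # w) r \<longleftrightarrow> (\<exists>q. (p, a, q) \<in> transitions A \<and> nfa_run A q w r)"
  by (auto intro: nfa_run.Cons elim: nfa_run.cases)

lemma nfa_run_append:
  "nfa_run A p (v @ w) r \<longleftrightarrow> (\<exists>q. nfa_run A p v q \<and> nfa_run A q w r)"
proof (induction v arbitrary: p)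
  case Nil
  show ?case by (simp add: nfa_run_Nil_iff)
next
  case (Cons a v)
  then show ?case by (auto simp: nfa_run_Cons_iff)
qed

lemma nfa_run_pathE:
  assumes "nfa_run A p w r"
  obtains \<rho> where "\<rho> 0 = p" "\<rho> (length w) = r"
    "\<And>i. i < length w \<Longrightarrow> (\<rho> i, w ! i, \<rho> (Suc i)) \<in> transitions A"
proof -
  have "\<exists>\<rho>. \<rho> 0 = p \<and> \<rho> (length w) = r \<and>
      (\<forall>i<length w. (\<rho> i, w ! i, \<rho> (Suc i)) \<in> transitions A)"
    using assms
  proof induction
    case (Nil p)
    show ?case by (rule exI[of _ "\<lambda>_. p"]) simp
  next
    case (Cons p a q w r)
    then obtain \<rho> where \<rho>: "\<rho> 0 = q" "\<rho> (length w) = r"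
      "\<forall>i<length w. (\<rho> i, w ! i, \<rho> (Suc i)) \<in> transitions A" by blast
    show ?case
      by (rule exI[of _ "case_nat p \<rho>"]) (use \<rho> Cons.hyps in \<open>auto simp: nth_Cons split: nat.split\<close>)
  qed
  with that show ?thesis by blast
qed

lemma nfa_run_path_segment:
  assumes "\<And>i. i < length w \<Longrightarrow> (\<rho> i, w ! i, \<rho> (Suc i)) \<in> transitions A"
    and "a \<le> b" "b \<le> length w"
  shows "nfa_run A (\<rho> a) (take (b - a) (drop a w)) (\<rho> b)"
  using assms(2)
proof (induction a rule: inc_induct)
  case base
  show ?case by (simp add: nfa_run.Nil)
next
  case (step k)
  then have "drop k w = w ! k # drop (Suc k) w" "b - k = Suc (b - Suc k)"
    using assms(3) by (simp_all add: Cons_nth_drop_Suc)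
  then have "take (b - k) (drop k w) = w ! k # take (b - Suc k) (drop (Suc k) w)"
    by simp
  moreover have "(\<rho> k, w ! k, \<rho> (Suc k)) \<in> transitions A" using assms(1,3) step.hyps by simp
  ultimately show ?case using step.IH by (auto simp: nfa_run_Cons_iff)
qed

definition step :: "('q, 'a) nfa \<Rightarrow> ('q \<times> 'q) set" where
  "step A = {(p, q). \<exists>a. (p, a, q) \<in> transitions A}"

lemma relpow_step_iff: "(p, q) \<in> step A ^^ k \<longleftrightarrow> (\<exists>w. length w = k \<and> nfa_run A p w q)"
proof (induction k arbitrary: p)
  case 0
  show ?case by (auto simp: nfa_run_Nil_iff)
next
  case (Suc k)
  have "(p, q) \<in> step A ^^ Suc k \<longleftrightarrow> (\<exists>r. (p, r) \<in> step A \<and> (r, q) \<in> step A ^^ k)"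
    by (meson relpow_Suc_D2 relpow_Suc_I2)
  also have "\<dots> \<longleftrightarrow> (\<exists>a w. length w = k \<and> nfa_run A p (a # w) q)"
    unfolding Suc nfa_run_Cons_iff by (auto simp: step_def)
  also have "\<dots> \<longleftrightarrow> (\<exists>w. length w = Suc k \<and> nfa_run A p w q)"
    unfolding length_Suc_conv by blast
  finally show ?case .
qed

lemma finite_step:
  assumes "is_nfa A"
  shows "finite (step A)"
proof (rule finite_subset)
  show "step A \<subseteq> states A \<times> states A"
    using assms by (auto simp: is_nfa_def step_def)
qed (use assms in \<open>auto simp: is_nfa_def\<close>)

text \<open>Pigeonhole: the powers take finitely many values, so two coincide, and composing both
  with further powers of \<open>r\<close> propagates the coincidence to all later exponents.\<close>

lemma relpow_eventually_periodic:
  fixes r :: "('b \<times> 'b) set"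
  assumes "finite r"
  obtains m b where "m > 0" "\<And>k. k \<ge> b \<Longrightarrow> r ^^ (k + m) = r ^^ k"
proof -
  \<comment> \<open>Only positive powers are confined to this finite product: \<open>r ^^ 0\<close>
    is the identity on the whole, possibly infinite, type.\<close>
  have "r ^^ Suc k \<subseteq> Domain r \<times> Range r" for k
  proof (intro subrelI SigmaI)
    fix p q assume pq: "(p, q) \<in> r ^^ Suc k"
    then show "p \<in> Domain r" by (blast dest: relpow_Suc_D2)
    from pq show "q \<in> Range r" by auto
  qed
  then have "range (\<lambda>k. r ^^ Suc k) \<subseteq> Pow (Domain r \<times> Range r)" by blast
  moreover have "finite (Pow (Domain r \<times> Range r))"
    using assms by (simp add: finite_Domain finite_Range)
  ultimately have "finite (range (\<lambda>k. r ^^ Suc k))" by (rule finite_subset)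
  then have "\<not> inj (\<lambda>k. r ^^ Suc k)"
    using finite_imageD by fastforce
  then obtain i' j' where "i' \<noteq> j'" "r ^^ Suc i' = r ^^ Suc j'"
    unfolding inj_def by blast
  then obtain i j where ij: "i < j" "r ^^ Suc i = r ^^ Suc j"
    by (metis linorder_neqE_nat)
  show thesis
  proof
    show "j - i > 0" using ij by simp
    fix k assume "k \<ge> Suc i"
    then obtain d where "k = Suc i + d" using le_Suc_ex by blast
    moreover from this ij have "k + (j - i) = Suc j + d" by simp
    ultimately show "r ^^ (k + (j - i)) = r ^^ k"
      using ij by (simp only: relpow_add)
  qed
qed

section \<open>Corrections of the input on a prefix\<close>

definition mism :: "'a list \<Rightarrow> 'a list \<Rightarrow> nat" where
  "mism u w = card {i. i < length w \<and> w ! i \<noteq> u ! i}"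

lemma mism_append_le: "mism u (w @ w') \<le> mism u w + length w'"
proof -
  have "{i. i < length (w @ w') \<and> (w @ w') ! i \<noteq> u ! i} \<subseteq>
     {i. i < length w \<and> w ! i \<noteq> u ! i} \<union> {length w..<length w + length w'}"
    by (auto simp: nth_append)
  then have "mism u (w @ w') \<le> card ({i. i < length w \<and> w ! i \<noteq> u ! i} \<union> {length w..<length w + length w'})"
    unfolding mism_def by (intro card_mono) auto
  also have "\<dots> \<le> mism u w + length w'"
    unfolding mism_def by (rule order.trans[OF card_Un_le]) simp
  finally show ?thesis .
qed

lemma mism_append_copy:
  assumes "length w \<le> length u"
  shows "mism u (w @ take k (drop (length w) u)) = mism u w"
  unfolding mism_def
  by (rule arg_cong[of _ _ card], rule Collect_cong) (use assms in \<open>auto simp: nth_append\<close>)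

lemma mism_take_le: "mism u (take k w) \<le> mism u w"
  unfolding mism_def by (intro card_mono) auto

section \<open>Blocking intervals\<close>

text \<open>One constant \<open>B\<close> has two purposes: whether a walk of length at least
  \<open>B\<close> joins two states depends only on the length modulo \<open>m\<close>, and any
  \<open>B + 1\<close> consecutive states of a run contain a repetition.\<close>

locale periodic_nfa =
  fixes A :: "('q, 'a) nfa" and m B :: nat
  assumes is_nfa: "is_nfa A"
    and m_pos: "m > 0"
    and card_states_le: "card (states A) \<le> B"
    and periodic: "k \<ge> B \<Longrightarrow> step A ^^ (k + m) = step A ^^ k"
begin

text \<open>A node is a state together with a point in time, which only matters modulo \<^term>\<open>m\<close>.\<close>

definition reach :: "'q \<times> nat \<Rightarrow> 'q \<times> nat \<Rightarrow> bool" where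
  "reach x y \<longleftrightarrow> (\<exists>l. (fst x, fst y) \<in> step A ^^ l \<and> [snd x + l = snd y] (mod m))"

definition recurrent :: "'q \<times> nat \<Rightarrow> bool" where
  "recurrent v \<longleftrightarrow> (\<exists>l>0. (fst v, fst v) \<in> step A ^^ l)"

text \<open>For \<open>a \<le> b \<le> length u\<close>, the two \<open>reach\<close> conditions and
  the run close a cycle through \<open>v\<close>, so the factor would be read inside the strongly
  connected component of \<open>v\<close>.\<close>

definition blocking :: "'a list \<Rightarrow> 'q \<times> nat \<Rightarrow> nat \<Rightarrow> nat \<Rightarrow> bool" where
  "blocking u v a b \<longleftrightarrow>
     (\<nexists>x y. reach v (x, a) \<and> nfa_run A x (take (b - a) (drop a u)) y \<and> reach (y, b) v)"

text \<open>The corrected prefix need not have entered the component of \<open>v\<close>, it must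
  only be able to reach it; this makes the notion pass to earlier times and to nodes reachable from
  \<open>v\<close>.\<close>

definition near :: "'a list \<Rightarrow> 'q \<times> nat \<Rightarrow> nat \<Rightarrow> nat \<Rightarrow> bool" where
  "near u v t c \<longleftrightarrow> (\<exists>p\<in>initials A. \<exists>w x.
     length w = t \<and> nfa_run A p w x \<and> reach (x, t) v \<and> mism u w \<le> c)"

section \<open>Walks of prescribed length between nodes\<close>

lemma relpow_cong_eq:
  assumes "a \<ge> B" "b \<ge> B" "[a = b] (mod m)"
  shows "step A ^^ a = step A ^^ b"
proof -
  have *: "step A ^^ (k + j * m) = step A ^^ k" if "k \<ge> B" for k j
  proof (induction j)
    case (Suc j)
    have "step A ^^ (k + Suc j * m) = step A ^^ ((k + j * m) + m)"
      by (simp add: algebra_simps)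
    also have "\<dots> = step A ^^ k" using periodic[of "k + j * m"] that Suc by simp
    finally show ?case .
  qed simp
  have "\<exists>j. y = x + j * m" if "x \<le> y" "[x = y] (mod m)" for x y
    using that by (metis cong_def mod_eq_nat1E mult.commute)
  with * assms show ?thesis
    by (metis nat_le_linear cong_sym)
qed

lemma reach_cong:
  assumes "reach (p, s) (q, t)" "[s = s'] (mod m)" "[t = t'] (mod m)"
  shows "reach (p, s') (q, t')"
proof -
  from assms(1) obtain l where l: "(p, q) \<in> step A ^^ l" "[s + l = t] (mod m)"
    unfolding reach_def by auto
  have "[s' + l = s + l] (mod m)"
    using assms(2) by (simp add: cong_add_rcancel_nat cong_sym)
  with l assms(3) have "[s' + l = t'] (mod m)" by (meson cong_trans)
  with l(1) show ?thesis unfolding reach_def by auto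
qed

lemma reach_refl: "reach (p, s) (p, s)"
  unfolding reach_def by (auto intro!: exI[of _ 0])

lemma reach_trans:
  assumes "reach x y" "reach y z"
  shows "reach x z"
proof -
  from assms obtain k l where kl: "(fst x, fst y) \<in> step A ^^ k" "[snd x + k = snd y] (mod m)"
    "(fst y, fst z) \<in> step A ^^ l" "[snd y + l = snd z] (mod m)"
    unfolding reach_def by blast
  then have "(fst x, fst z) \<in> step A ^^ (k + l)"
    by (auto simp: relpow_add)
  moreover have "[snd x + (k + l) = snd z] (mod m)"
    using kl(2,4) by (metis add.assoc cong_add_rcancel_nat cong_trans)
  ultimately show ?thesis unfolding reach_def by blast
qed

lemma reach_run: "nfa_run A p w q \<Longrightarrow> reach (p, t) (q, t + length w)"
  unfolding reach_def by (auto simp: relpow_step_iff)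

lemma recurrent_pumpE:
  assumes "recurrent v"
  obtains l where "l \<ge> k" "(fst v, fst v) \<in> step A ^^ l" "[l = 0] (mod m)"
proof -
  from assms obtain c where c: "c > 0" "(fst v, fst v) \<in> step A ^^ c"
    unfolding recurrent_def by blast
  have "(fst v, fst v) \<in> step A ^^ (j * c)" for j
  proof (induction j)
    case (Suc j)
    with c(2) show ?case by (auto simp: relpow_add)
  qed simp
  then have "(fst v, fst v) \<in> step A ^^ ((k * m) * c)" .
  moreover have "k * m * c \<ge> k" using c m_pos by simp
  moreover have "[k * m * c = 0] (mod m)" by (simp add: cong_0_iff)
  ultimately show thesis using that by blast
qed

text \<open>Walk from \<open>p\<close> to \<open>v\<close>, go round a cycle at \<open>v\<close> for
  at least \<open>B\<close> steps without changing the residue modulo \<open>m\<close>, then walk to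
  \<open>q\<close>. The total length agrees with \<open>l\<close> modulo \<open>m\<close>, so
  periodicity replaces it by \<open>l\<close>.\<close>

lemma reach_exact:
  assumes "reach (p, r) v" "recurrent v" "reach v (q, r + l)" "l \<ge> B"
  shows "(p, q) \<in> step A ^^ l"
proof -
  from assms obtain k k' where k: "(p, fst v) \<in> step A ^^ k" "[r + k = snd v] (mod m)"
    "(fst v, q) \<in> step A ^^ k'" "[snd v + k' = r + l] (mod m)"
    unfolding reach_def by auto
  obtain j where j: "j \<ge> B" "(fst v, fst v) \<in> step A ^^ j" "[j = 0] (mod m)"
    using recurrent_pumpE[OF assms(2)] by blast
  have "(p, q) \<in> step A ^^ (k + j + k')"
    using k j by (auto simp: relpow_add)
  moreover have "[r + (k + j + k') = r + l] (mod m)"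
  proof -
    have "[r + k + k' = r + l] (mod m)"
      using k by (meson cong_add_rcancel_nat cong_trans)
    from cong_add[OF this j(3)] have "[r + k + k' + j = r + l + 0] (mod m)" .
    then show ?thesis by (simp add: algebra_simps)
  qed
  then have "[k + j + k' = l] (mod m)" by (simp add: cong_add_lcancel_nat)
  ultimately show ?thesis
    using relpow_cong_eq[of "k + j + k'" l] j(1) assms(4) by auto
qed

text \<open>Prolong a walk from \<open>p\<close> to \<open>v\<close> by cycling at \<open>v\<close>
  until it has at least \<open>k\<close> steps, and cut it after \<open>k\<close>: the remainder
  still leads to \<open>v\<close>.\<close>

lemma reach_stay:
  assumes "reach (p, r) v" "recurrent v"
  obtains y where "(p, y) \<in> step A ^^ k" "reach (y, r + k) v"
proof -
  from assms obtain l where l: "(p, fst v) \<in> step A ^^ l" "[r + l = snd v] (mod m)"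
    unfolding reach_def by auto
  obtain j where j: "j \<ge> k" "(fst v, fst v) \<in> step A ^^ j" "[j = 0] (mod m)"
    using recurrent_pumpE[OF assms(2)] by blast
  have "(p, fst v) \<in> step A ^^ (l + j)"
    using l j by (auto simp: relpow_add)
  moreover have "l + j = k + (l + j - k)" using j(1) by simp
  ultimately have "(p, fst v) \<in> step A ^^ k O step A ^^ (l + j - k)"
    by (metis relpow_add)
  then obtain y where y: "(p, y) \<in> step A ^^ k" "(y, fst v) \<in> step A ^^ (l + j - k)"
    by blast
  have "[(r + l) + j = snd v + 0] (mod m)" by (intro cong_add l j)
  then have "[(r + k) + (l + j - k) = snd v] (mod m)" using j(1) by (simp add: algebra_simps)
  with y that show thesis unfolding reach_def by auto
qed

section \<open>Cheaply corrected prefixes\<close>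

lemma near_0: "p \<in> initials A \<Longrightarrow> reach (p, 0) v \<Longrightarrow> near u v 0 0"
  unfolding near_def by (force simp: mism_def intro: nfa_run.Nil)

lemma near_mono: "near u v t c \<Longrightarrow> c \<le> c' \<Longrightarrow> near u v t c'"
  unfolding near_def by (meson order.trans)

lemma near_reach: "near u v t c \<Longrightarrow> reach v v' \<Longrightarrow> near u v' t c"
  unfolding near_def by (meson reach_trans)

lemma near_earlier:
  assumes "near u v t c" "t' \<le> t"
  shows "near u v t' c"
proof -
  from assms obtain p w x where *: "p \<in> initials A" "length w = t" "nfa_run A p w x"
    "reach (x, t) v" "mism u w \<le> c" unfolding near_def by blast
  then obtain y where y: "nfa_run A p (take t' w) y" "nfa_run A y (drop t' w) x"
    by (metis append_take_drop_id nfa_run_append)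
  have "reach (y, t') (x, t)"
    using reach_run[OF y(2), of t'] * assms by simp
  moreover have "mism u (take t' w) \<le> c"
    using mism_take_le *(5) order.trans by blast
  ultimately show ?thesis
    unfolding near_def using * y(1) assms(2) reach_trans[of "(y, t')" "(x, t)" v]
    by (intro bexI[OF _ *(1)] exI[of _ "take t' w"] exI[of _ y] conjI) simp_all
qed

lemma near_stay:
  assumes "near u v t c" "recurrent v"
  shows "near u v (t + k) (c + k)"
proof -
  from assms obtain p w x where *: "p \<in> initials A" "length w = t" "nfa_run A p w x"
    "reach (x, t) v" "mism u w \<le> c" unfolding near_def by blast
  obtain y where y: "(x, y) \<in> step A ^^ k" "reach (y, t + k) v"
    using reach_stay * assms by blast
  then obtain w' where w': "length w' = k" "nfa_run A x w' y"
    by (auto simp: relpow_step_iff)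
  have "mism u (w @ w') \<le> c + k" using mism_append_le[of u w w'] * w' by simp
  moreover have "nfa_run A p (w @ w') y"
    unfolding nfa_run_append using * w' by blast
  ultimately show ?thesis
    unfolding near_def using * y w'
    by (intro bexI[OF _ *(1)] exI[of _ "w @ w'"] exI[of _ y] conjI) simp_all
qed

text \<open>Overwriting \<open>B\<close> letters suffices to move to the start of a run that reads
  the non-blocking factor, after which \<open>u\<close> is copied at no cost.\<close>

lemma near_copy:
  assumes "near u v t c" "recurrent v" "\<not> blocking u v (t + B) b" "t + B \<le> b" "b \<le> length u"
  shows "near u v b (c + B)"
proof -
  from assms obtain p w x where *: "p \<in> initials A" "length w = t" "nfa_run A p w x"
    "reach (x, t) v" "mism u w \<le> c" unfolding near_def by blast
  from assms obtain y z where y: "reach v (y, t + B)"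
    "nfa_run A y (take (b - (t + B)) (drop (t + B) u)) z" "reach (z, b) v"
    unfolding blocking_def by blast
  have "(x, y) \<in> step A ^^ B"
    using reach_exact * y assms by blast
  then obtain w' where w': "length w' = B" "nfa_run A x w' y"
    by (auto simp: relpow_step_iff)
  let ?w = "(w @ w') @ take (b - (t + B)) (drop (t + B) u)"
  have "mism u ?w = mism u (w @ w')"
    using mism_append_copy[of "w @ w'" u "b - (t + B)"] * w' assms by simp
  also have "\<dots> \<le> c + B" using mism_append_le[of u w w'] * w' by simp
  finally have "mism u ?w \<le> c + B" .
  moreover have "nfa_run A p ?w z"
    unfolding nfa_run_append using * w' y by blast
  moreover have "length ?w = b"
    using * w' assms by simp
  ultimately show ?thesis
    unfolding near_def using *(1) y(3) by blast
qed

text \<open>The component of a recurrent node has a node at every time, and that node reads the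
  empty word without leaving the component.\<close>

lemma blocking_nonempty:
  assumes "recurrent v" "blocking u v a b"
  shows "a \<noteq> b"
proof
  assume "a = b"
  obtain x where x: "reach v (x, a)" "reach (x, a) v"
  proof -
    obtain k where k: "[snd v + k = a] (mod m)"
    proof
      have "[snd v * m + a = 0 + a] (mod m)"
        by (intro cong_add) (auto simp: cong_0_iff)
      then show "[snd v + ((m - 1) * snd v + a) = a] (mod m)"
        using m_pos by (cases m) (auto simp: algebra_simps)
    qed
    obtain y where y: "(fst v, y) \<in> step A ^^ k" "reach (y, snd v + k) v"
      using reach_stay[of "fst v" "snd v" v k] reach_refl[of "fst v" "snd v"] assms by auto
    have "reach v (y, a)" using y k unfolding reach_def by auto
    moreover have "reach (y, a) v"
      using reach_cong[of y "snd v + k" "fst v" "snd v" a "snd v"] y k by auto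
    ultimately show thesis using that by blast
  qed
  with \<open>a = b\<close> assms(2) show False unfolding blocking_def by (auto intro: nfa_run.Nil)
qed

text \<open>
  Greedy correction: follow \<^term>\<open>u\<close> until the first blocking interval ends, then overwrite
  \<^term>\<open>B\<close> letters in order to return to a state from which the run can continue along \<^term>\<open>u\<close>.
\<close>

lemma near_or_blocking:
  assumes "recurrent v" "near u v s c" "s \<le> t" "t \<le> length u"
  shows "near u v t (c + N * (B + 1)) \<or>
    (\<exists>J. finite J \<and> card J = N \<and> disjoint J \<and>
      (\<forall>I\<in>J. \<exists>a b. s \<le> a \<and> a < b \<and> b \<le> t \<and> I = {a..<b} \<and> blocking u v a b))"
  using assms(2,3)
proof (induction N arbitrary: s c)
  case 0
  show ?case by (rule disjI2, rule exI[of _ "{}"]) auto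
next
  case (Suc N)
  show ?case
  proof (cases "s + B \<le> t \<and> (\<exists>j\<ge>s + B. j \<le> t \<and> blocking u v (s + B) j)")
    case False
    have "near u v t (c + B)"
    proof (cases "s + B \<le> t")
      case True
      with False show ?thesis using near_copy[OF Suc.prems(1) assms(1)] assms(4) by auto
    next
      case False
      then show ?thesis using near_stay[OF Suc.prems(1) assms(1), of "t - s"] Suc.prems
        by (auto intro: near_mono)
    qed
    then show ?thesis by (auto intro: near_mono)
  next
    case True
    \<comment> \<open>\<open>j\<close> is the first blocking end, so the factor up to
      \<open>j - 1\<close> is copied after \<open>B\<close> corrections; passing the letter at
      \<open>j - 1\<close> costs at most one more, hence \<open>B + 1\<close> per interval.\<close>
    define j where "j = (LEAST j. j \<ge> s + B \<and> blocking u v (s + B) j)"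
    from True obtain j0 where j0: "j0 \<ge> s + B" "j0 \<le> t" "blocking u v (s + B) j0" by blast
    have j: "j \<ge> s + B" "blocking u v (s + B) j"
      unfolding j_def using LeastI[of "\<lambda>j. j \<ge> s + B \<and> blocking u v (s + B) j" j0] j0 by auto
    have "j \<le> j0" unfolding j_def using j0 by (intro Least_le) auto
    with j0 have "j \<le> t" by simp
    have "j > s + B" using j blocking_nonempty[OF assms(1)] by (metis le_neq_implies_less)
    then have "\<not> blocking u v (s + B) (j - 1)" "s + B \<le> j - 1"
      using not_less_Least[of "j - 1" "\<lambda>j. j \<ge> s + B \<and> blocking u v (s + B) j"]
      by (auto simp: j_def[symmetric])
    then have "near u v (j - 1) (c + B)"
      using near_copy Suc.prems assms \<open>j \<le> t\<close> by auto
    then have "near u v j (c + B + 1)"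
      using near_stay[of u v "j - 1" _ 1] assms(1) \<open>j > s + B\<close> by fastforce
    from Suc.IH[OF this \<open>j \<le> t\<close>] show ?thesis
    proof
      assume "\<exists>J. finite J \<and> card J = N \<and> disjoint J \<and>
        (\<forall>I\<in>J. \<exists>a b. j \<le> a \<and> a < b \<and> b \<le> t \<and> I = {a..<b} \<and> blocking u v a b)"
      then obtain J where J: "finite J" "card J = N" "disjoint J"
        "\<And>I. I \<in> J \<Longrightarrow> \<exists>a b. j \<le> a \<and> a < b \<and> b \<le> t \<and> I = {a..<b} \<and> blocking u v a b"
        by blast
      let ?I = "{s + B..<j}"
      have disj: "I \<inter> ?I = {}" if "I \<in> J" for I using J(4)[OF that] by auto
      then have "?I \<notin> J" using \<open>j > s + B\<close> by force
      moreover have "disjoint (insert ?I J)"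
        using J(3) disj unfolding pairwise_insert disjnt_def by blast
      moreover have "\<exists>a b. s \<le> a \<and> a < b \<and> b \<le> t \<and> I = {a..<b} \<and> blocking u v a b"
        if I: "I \<in> insert ?I J" for I
      proof (cases "I = ?I")
        case True
        with j \<open>j > s + B\<close> \<open>j \<le> t\<close> show ?thesis by (intro exI[of _ "s + B"] exI[of _ j]) auto
      next
        case False
        with I J(4)[of I] \<open>j > s + B\<close> show ?thesis
          by (metis insert_iff le_add1 less_imp_le order.trans)
      qed
      ultimately show ?thesis using J
        by (intro disjI2 exI[of _ "insert ?I J"]) auto
    qed (auto simp: algebra_simps)
  qed
qed

section \<open>Accepting runs and components\<close>

lemma recurrent_visit:
  assumes "\<And>i. i < length w \<Longrightarrow> (\<rho> i, w ! i, \<rho> (Suc i)) \<in> transitions A"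
    and "\<And>i. i \<le> length w \<Longrightarrow> \<rho> i \<in> states A"
    and "a + B \<le> length w"
  obtains i where "a \<le> i" "i \<le> a + B" "\<And>t. recurrent (\<rho> i, t)"
proof -
  \<comment> \<open>\<open>B + 1\<close> positions cannot carry distinct states, and the factor
    between two equal ones is a cycle.\<close>
  have "\<not> inj_on \<rho> {a..a + B}"
  proof
    assume "inj_on \<rho> {a..a + B}"
    moreover have "\<rho> ` {a..a + B} \<subseteq> states A" using assms by auto
    ultimately have "card {a..a + B} \<le> card (states A)"
      using is_nfa by (intro card_inj_on_le) (auto simp: is_nfa_def)
    with card_states_le show False by simp
  qed
  then obtain i j where ij: "a \<le> i" "i < j" "j \<le> a + B" "\<rho> i = \<rho> j"
    unfolding inj_on_def by (metis atLeastAtMost_iff linorder_neqE_nat)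
  have "nfa_run A (\<rho> i) (take (j - i) (drop i w)) (\<rho> j)"
    using ij assms by (intro nfa_run_path_segment) auto
  moreover have "length (take (j - i) (drop i w)) = j - i" using ij assms by simp
  ultimately have "(\<rho> i, \<rho> j) \<in> step A ^^ (j - i)" unfolding relpow_step_iff by blast
  with ij have "recurrent (\<rho> i, t)" for t unfolding recurrent_def by (auto intro!: exI[of _ "j - i"])
  with ij that show thesis by force
qed

lemma path_states:
  assumes "\<rho> 0 \<in> initials A" "\<And>i. i < length w \<Longrightarrow> (\<rho> i, w ! i, \<rho> (Suc i)) \<in> transitions A"
    and "i \<le> length w"
  shows "\<rho> i \<in> states A"
proof (cases i)
  case 0
  with assms(1) is_nfa show ?thesis unfolding is_nfa_def by auto
next
  case (Suc j)
  with assms(3) have "(\<rho> j, w ! j, \<rho> i) \<in> transitions A" using assms(2)[of j] by simp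
  with is_nfa show ?thesis unfolding is_nfa_def by auto
qed

lemma path_reach:
  assumes "\<And>i. i < length w \<Longrightarrow> (\<rho> i, w ! i, \<rho> (Suc i)) \<in> transitions A"
    and "a \<le> b" "b \<le> length w"
  shows "reach (\<rho> a, a) (\<rho> b, b)"
  using reach_run[OF nfa_run_path_segment[where w = w], of \<rho> a b a] assms by simp

text \<open>One node per state and residue keeps the size bounded independently of \<open>n\<close>;
  recurrent nodes suffice because every run meets one within \<open>B\<close> steps.\<close>

definition core :: "nat \<Rightarrow> ('q \<times> nat) set" where
  "core n = {v \<in> states A \<times> {..<m}. recurrent v \<and>
     (\<exists>p\<in>initials A. reach (p, 0) v) \<and> (\<exists>q\<in>finals A. reach v (q, n))}"

lemma finite_core: "finite (core n)"
  and card_core_le: "card (core n) \<le> card (states A) * m"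
proof -
  have *: "finite (states A \<times> {..<m})" "core n \<subseteq> states A \<times> {..<m}"
    using is_nfa by (auto simp: is_nfa_def core_def)
  then show "finite (core n)" by (rule rev_finite_subset)
  from card_mono[OF *] show "card (core n) \<le> card (states A) * m"
    by (simp add: card_cartesian_product)
qed

text \<open>The last \<open>B\<close> letters are spent on a walk of exactly that length into a
  final state (\<open>reach_exact\<close>).\<close>

lemma near_accept:
  assumes "near u v (n - B) c" "v \<in> core n" "B \<le> n"
  obtains z where "z \<in> nfa_lang A" "length z = n" "mism u z \<le> c + B"
proof -
  from assms(1) obtain p w x where *: "p \<in> initials A" "length w = n - B" "nfa_run A p w x"
    "reach (x, n - B) v" "mism u w \<le> c" unfolding near_def by blast
  from assms(2) obtain q where q: "q \<in> finals A" "reach v (q, n)" "recurrent v"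
    unfolding core_def by blast
  have "(x, q) \<in> step A ^^ B"
    using reach_exact[of x "n - B" v q B] * q assms(3) by simp
  then obtain w' where w': "length w' = B" "nfa_run A x w' q"
    by (auto simp: relpow_step_iff)
  show thesis
  proof
    show "w @ w' \<in> nfa_lang A"
      unfolding nfa_lang_def mem_Collect_eq nfa_run_append using *(1,3) q(1) w'(2) by blast
    show "length (w @ w') = n" using * w' assms by simp
    show "mism u (w @ w') \<le> c + B" using mism_append_le[of u w w'] * w' by simp
  qed
qed

text \<open>
  Components are treated in topological order. An accepting run that agrees with \<^term>\<open>u\<close> on an
  interval blocking for a component cannot be inside that component during the whole interval, so
  it leaves the component before the latest time at which the component is still cheaply
  reachable. Hence it has left all components too early to be in one near the end of the word.
\<close>

lemma blocking_families:
  assumes "B \<le> length u"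
    and far: "\<And>z. z \<in> nfa_lang A \<Longrightarrow> length z = length u \<Longrightarrow>
      mism u z > (N + 1) * (B + 1) * (card (states A) * m + 1) + B"
  obtains F where "finite F" "card F \<le> card (states A) * m"
    "\<And>J. J \<in> F \<Longrightarrow> finite J \<and> card J = N \<and> disjoint J"
    "\<And>J I. J \<in> F \<Longrightarrow> I \<in> J \<Longrightarrow> \<exists>a b. a < b \<and> b \<le> length u \<and> I = {a..<b}"
    "\<And>z. z \<in> nfa_lang A \<Longrightarrow> length z = length u \<Longrightarrow> \<exists>J\<in>F. \<forall>I\<in>J. \<exists>i\<in>I. z ! i \<noteq> u ! i"
proof -
  let ?n = "length u" and ?K = "card (states A) * m"
  let ?V = "core ?n"
  \<comment> \<open>Budget per level: one \<open>B + 1\<close> to step past \<open>s v\<close>, and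
    \<open>N\<close> times \<open>B + 1\<close> for the greedy correction.\<close>
  define c where "c = (N + 1) * (B + 1)"
  \<comment> \<open>\<open>h\<close> is a level that strictly increases along strict reachability,
    so the budget of \<open>v\<close> exceeds that of each strict predecessor by at least
    \<open>c\<close>. \<open>tv v\<close> is the last time at which \<open>v\<close> is near within
    its budget, and \<open>s v\<close> the largest such time over the predecessors.\<close>
  define P where "P v = {x \<in> ?V. reach x v \<and> \<not> reach v x}" for v
  define h where "h v = card (P v)" for v
  define S where "S v = {t. t \<le> ?n \<and> near u v t (c * (h v + 1))}" for v
  define tv where "tv v = Max (S v)" for v
  define s where "s v = Max (insert 0 (tv ` P v))" for v
  have fin_P: "finite (P v)" for v using finite_core unfolding P_def by simp
  have h_less: "h x < h v" if "x \<in> P v" for x v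
    unfolding h_def
  proof (rule psubset_card_mono[OF fin_P])
    show "P x \<subset> P v"
      using that reach_trans unfolding P_def by blast
  qed
  have h_le: "h v \<le> ?K" for v
    using card_mono[OF finite_core, of "P v" ?n] card_core_le[of ?n] unfolding h_def P_def by auto
  have fin_S: "finite (S v)" for v unfolding S_def by simp
  have S_ne: "S v \<noteq> {}" if "v \<in> ?V" for v
  proof -
    from that obtain p where "p \<in> initials A" "reach (p, 0) v" unfolding core_def by blast
    then have "near u v 0 (c * (h v + 1))" using near_0 near_mono le0 by metis
    then show ?thesis unfolding S_def by blast
  qed
  have tv: "tv v \<le> ?n" "near u v (tv v) (c * (h v + 1))" if "v \<in> ?V" for v
    using Max_in[OF fin_S S_ne[OF that]] unfolding tv_def S_def by auto
  have tv_max: "t \<le> tv v" if "near u v t (c * (h v + 1))" "t \<le> ?n" for v t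
    unfolding tv_def by (rule Max_ge[OF fin_S]) (use that in \<open>auto simp: S_def\<close>)
  \<comment> \<open>Otherwise \<open>near_accept\<close> would give an accepted word closer to
    \<open>u\<close> than \<open>far\<close> allows.\<close>
  have tv_less: "tv v + B < ?n" if v: "v \<in> ?V" for v
  proof (rule ccontr)
    assume "\<not> tv v + B < ?n"
    then have "near u v (?n - B) (c * (h v + 1))"
      using near_earlier[OF tv(2)[OF v]] by simp
    then obtain z where z: "z \<in> nfa_lang A" "length z = ?n" "mism u z \<le> c * (h v + 1) + B"
      using near_accept v assms(1) by blast
    have "c * (h v + 1) \<le> c * (?K + 1)" using h_le by (intro mult_le_mono) auto
    with z far[OF z(1,2)] show False unfolding c_def by linarith
  qed
  have s: "near u v (s v) (c * h v)" if v: "v \<in> ?V" for v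
  proof -
    have "s v \<in> insert 0 (tv ` P v)" unfolding s_def using fin_P by (intro Max_in) auto
    then show ?thesis
    proof
      assume "s v = 0"
      moreover from v obtain p where "p \<in> initials A" "reach (p, 0) v" unfolding core_def by blast
      ultimately show ?thesis using near_0 near_mono le0 by metis
    next
      assume "s v \<in> tv ` P v"
      then obtain x where x: "x \<in> P v" "s v = tv x" by blast
      then have "near u v (s v) (c * (h x + 1))"
        using tv(2)[of x] near_reach unfolding P_def by auto
      moreover have "c * (h x + 1) \<le> c * h v"
        using h_less[OF x(1)] by (intro mult_le_mono) auto
      ultimately show ?thesis using near_mono by blast
    qed
  qed
  have s_ge: "tv x \<le> s v" if "x \<in> P v" for x v
    unfolding s_def using fin_P that by (intro Max_ge) auto
  have "\<exists>J. finite J \<and> card J = N \<and> disjoint J \<and>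
      (\<forall>I\<in>J. \<exists>a b. s v + B + 1 \<le> a \<and> a < b \<and> b \<le> tv v + 1 \<and> I = {a..<b} \<and> blocking u v a b)"
    if v: "v \<in> ?V" for v
  proof -
    have rec: "recurrent v" using v unfolding core_def by blast
    \<comment> \<open>Maximality of \<open>tv v\<close> excludes the first alternative of
      \<open>near_or_blocking\<close> at time \<open>tv v + 1\<close>, which leaves the
      \<open>N\<close> blocking intervals.\<close>
    have not_near: "\<not> near u v (tv v + 1) (c * (h v + 1))"
      using tv_max[of v "tv v + 1"] tv_less[OF v] by auto
    have near1: "near u v (s v + (B + 1)) (c * h v + (B + 1))"
      by (rule near_stay[OF s[OF v] rec])
    have "s v + (B + 1) \<le> tv v + 1"
    proof (rule ccontr)
      assume "\<not> ?thesis"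
      then have "near u v (tv v + 1) (c * h v + (B + 1))" using near_earlier[OF near1] by simp
      moreover have "c * h v + (B + 1) \<le> c * (h v + 1)" unfolding c_def by simp
      ultimately show False using not_near near_mono by blast
    qed
    from near_or_blocking[OF rec near1 this, of N] tv_less[OF v] not_near
    show ?thesis unfolding c_def by (simp add: algebra_simps)
  qed
  then obtain J where J: "\<And>v. v \<in> ?V \<Longrightarrow> finite (J v) \<and> card (J v) = N \<and> disjoint (J v)"
    "\<And>v I. v \<in> ?V \<Longrightarrow> I \<in> J v \<Longrightarrow>
      \<exists>a b. s v + B + 1 \<le> a \<and> a < b \<and> b \<le> tv v + 1 \<and> I = {a..<b} \<and> blocking u v a b"
    by metis
  show thesis
  proof
    show "finite (J ` ?V)" using finite_core by simp
    show "card (J ` ?V) \<le> ?K" using card_image_le[OF finite_core, of J ?n] card_core_le[of ?n] by simp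
    show "finite J' \<and> card J' = N \<and> disjoint J'" if "J' \<in> J ` ?V" for J' using that J(1) by blast
    show "\<exists>a b. a < b \<and> b \<le> ?n \<and> I = {a..<b}" if J': "J' \<in> J ` ?V" "I \<in> J'" for J' I
    proof -
      from J' obtain v where v: "v \<in> ?V" "I \<in> J v" by blast
      from J(2)[OF v] tv_less[OF v(1)] show ?thesis
        by (metis Suc_eq_plus1 Suc_leI add_lessD1 le_trans)
    qed
    fix z assume z: "z \<in> nfa_lang A" "length z = ?n"
    show "\<exists>J'\<in>J ` ?V. \<forall>I\<in>J'. \<exists>i\<in>I. z ! i \<noteq> u ! i"
    proof (rule ccontr)
      assume "\<not> ?thesis"
      then have hit: "\<exists>I\<in>J v. \<forall>i\<in>I. z ! i = u ! i" if "v \<in> ?V" for v using that by simp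
      from z obtain p q where pq: "p \<in> initials A" "q \<in> finals A" "nfa_run A p z q"
        unfolding nfa_lang_def by blast
      from nfa_run_pathE[OF pq(3)] obtain \<rho> where \<rho>: "\<rho> 0 = p" "\<rho> (length z) = q"
        "\<And>i. i < length z \<Longrightarrow> (\<rho> i, z ! i, \<rho> (Suc i)) \<in> transitions A" by blast
      have st: "\<rho> i \<in> states A" if "i \<le> length z" for i
        using path_states[of \<rho> z i] \<rho> pq that by auto
      define nd where "nd i = (\<rho> i, i mod m)" for i
      have nd_reach: "reach (nd i) (nd j)" if "i \<le> j" "j \<le> ?n" for i j
        using reach_cong[OF path_reach[of z \<rho>, OF \<rho>(3)], of i j "i mod m" "j mod m"] that z(2)
        unfolding nd_def by (simp add: cong_def)
      have nd_core: "nd i \<in> ?V" if "i \<le> ?n" "recurrent (nd i)" for i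
      proof -
        have "reach (nd 0) (nd i)" "reach (nd i) (nd ?n)" using nd_reach that by auto
        then have "reach (p, 0) (nd i)" "reach (nd i) (q, ?n)"
          using \<rho> z reach_cong[of "\<rho> i" "i mod m" "\<rho> ?n" "?n mod m" "i mod m" ?n]
          unfolding nd_def by (auto simp: cong_def)
        then show ?thesis using that st z m_pos pq unfolding core_def by (auto simp: nd_def)
      qed
      have visit: "\<exists>i\<ge>a. i \<le> a + B \<and> recurrent (nd i)" if "a + B \<le> ?n" for a
        using recurrent_visit[of z \<rho> a, OF \<rho>(3) st] that z unfolding nd_def by metis
      have left: "\<not> reach (nd t) v" if "v \<in> ?V" "tv v < t" "t \<le> ?n" for v t
        using that
      proof (induction "h v" arbitrary: v t rule: less_induct)
        case less
        show ?case
        proof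
          assume r: "reach (nd t) v"
          from hit[OF less.prems(1)] obtain I where I: "I \<in> J v" "\<forall>i\<in>I. z ! i = u ! i" by blast
          with J(2)[OF less.prems(1)] obtain a b where ab: "s v + B + 1 \<le> a" "a < b" "b \<le> tv v + 1"
            "I = {a..<b}" "blocking u v a b" by blast
          \<comment> \<open>The gap of \<open>B + 1\<close> between \<open>s v\<close> and
            \<open>a\<close> makes the run meet a recurrent node after \<open>s v\<close> and no
            later than the start of the interval.\<close>
          obtain i where i: "s v + 1 \<le> i" "i \<le> s v + 1 + B" "recurrent (nd i)"
            using visit[of "s v + 1"] ab less.prems by auto
          have "i \<le> t" "i \<le> a" "b \<le> t" using ab i less.prems by auto
          have "reach (nd i) v" using reach_trans[OF nd_reach r] \<open>i \<le> t\<close> less.prems by simp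
          have core_i: "nd i \<in> ?V" using nd_core i \<open>i \<le> t\<close> less.prems by simp
          \<comment> \<open>Otherwise \<open>nd i\<close> is a strict predecessor of
            \<open>v\<close> with \<open>tv (nd i) \<le> s v < i\<close>, so by induction it is out
            of reach at time \<open>i\<close>, although it reaches itself.\<close>
          have "reach v (nd i)"
          proof (rule ccontr)
            assume "\<not> reach v (nd i)"
            then have "nd i \<in> P v" using \<open>reach (nd i) v\<close> core_i unfolding P_def by blast
            moreover from this have "tv (nd i) < i" using s_ge i(1) by fastforce
            ultimately show False
              using less.hyps[OF h_less core_i, of i] \<open>i \<le> t\<close> less.prems
                reach_refl[of "fst (nd i)" "snd (nd i)"] by auto
          qed
          then have "reach v (nd a)"
            using reach_trans nd_reach[OF \<open>i \<le> a\<close>] ab less.prems by simp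
          then have "reach v (\<rho> a, a)"
            using reach_cong[of "fst v" "snd v" "\<rho> a" "a mod m" "snd v" a] unfolding nd_def
            by (simp add: cong_def)
          moreover have "reach (\<rho> b, b) v"
          proof -
            have "reach (nd b) v" using reach_trans[OF nd_reach r] \<open>b \<le> t\<close> less.prems by simp
            then show ?thesis
              using reach_cong[of "\<rho> b" "b mod m" "fst v" "snd v" b "snd v"] unfolding nd_def
              by (simp add: cong_def)
          qed
          moreover have "nfa_run A (\<rho> a) (take (b - a) (drop a u)) (\<rho> b)"
          proof -
            have "take (b - a) (drop a u) = take (b - a) (drop a z)"
              using I(2) ab z less.prems by (intro nth_equalityI) auto
            then show ?thesis
              using nfa_run_path_segment[where w = z, OF \<rho>(3)] ab less.prems z by simp
          qed
          ultimately show False using ab(5) unfolding blocking_def by blast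
        qed
      qed
      \<comment> \<open>A recurrent node among the last \<open>B + 1\<close> positions comes after
        its own \<open>tv\<close>, yet reaches itself, contradicting \<open>left\<close>.\<close>
      obtain i where i: "i \<ge> ?n - B" "i \<le> ?n" "recurrent (nd i)"
        using visit[of "?n - B"] assms(1) by auto
      with nd_core have "nd i \<in> ?V" by simp
      with left[OF this, of i] tv_less[OF this] i reach_refl[of "fst (nd i)" "snd (nd i)"]
      show False by simp
    qed
  qed
qed

end

section \<open>Testing by random windows\<close>

primrec ask :: "nat list \<Rightarrow> ('a list \<Rightarrow> bool) \<Rightarrow> 'a query_alg" where
  "ask [] d = Halt (d [])"
| "ask (i # is) d = Query i (\<lambda>a. ask is (\<lambda>as. d (a # as)))"

lemma accepts_ask: "accepts (ask is d) u = d (map ((!) u) is)"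
  by (induction "is" arbitrary: d) auto

lemma queries_ask: "queries (ask is d) u = is"
  by (induction "is" arbitrary: d) auto

text \<open>Accepting exactly when the answers extend to a word of \<open>L\<close> gives one-sided
  error for any choice of positions.\<close>

definition consistent :: "'a list set \<Rightarrow> nat \<Rightarrow> nat list \<Rightarrow> 'a list \<Rightarrow> bool" where
  "consistent L n is as \<longleftrightarrow> (\<exists>z\<in>L. length z = n \<and> map ((!) z) is = as)"

definition windows :: "nat \<Rightarrow> nat \<Rightarrow> (nat \<Rightarrow> nat) \<Rightarrow> nat list" where
  "windows M n f =
     concat (map (\<lambda>j. filter (\<lambda>i. i < n) [f j - M div (j + 1)..<f j + M div (j + 1) + 1]) [0..<M])"

lemma set_windows:
  "set (windows M n f) = {i. i < n \<and> (\<exists>j<M. f j - M div (j + 1) \<le> i \<and> i \<le> f j + M div (j + 1))}"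
  unfolding windows_def by auto

text \<open>The radii sum to at most \<open>M\<close> times a harmonic number, which is at most
  \<open>1 + ln M\<close>.\<close>

lemma length_windows_le:
  assumes "M > 0"
  shows "real (length (windows M n f)) \<le> real M * (3 + 2 * ln (real M))"
proof -
  have "length (windows M n f) =
      (\<Sum>j<M. length (filter (\<lambda>i. i < n) [f j - M div (j + 1)..<f j + M div (j + 1) + 1]))"
    unfolding windows_def
    by (simp add: length_concat comp_def interv_sum_list_conv_sum_set_nat lessThan_atLeast0 del: upt_Suc)
  also have "\<dots> \<le> (\<Sum>j<M. 2 * (M div (j + 1)) + 1)"
    by (intro sum_mono order.trans[OF length_filter_le]) (simp del: upt_Suc)
  finally have "real (length (windows M n f)) \<le> real (\<Sum>j<M. 2 * (M div (j + 1)) + 1)"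
    by (rule of_nat_mono)
  also have "\<dots> = (\<Sum>j<M. 2 * real (M div (j + 1)) + 1)" by (simp add: add.commute)
  also have "\<dots> \<le> (\<Sum>j<M. 2 * (real M / real (j + 1)) + 1)"
    by (intro sum_mono add_mono mult_left_mono of_nat_div_le_of_nat) auto
  also have "\<dots> = real M * (1 + 2 * (\<Sum>j<M. 1 / real (j + 1)))"
    by (simp add: sum.distrib sum_distrib_left sum_distrib_right algebra_simps)
  also have "(\<Sum>j<M. 1 / real (j + 1)) = harm M"
    unfolding harm_def
    by (intro sum.reindex_bij_witness[of _ "\<lambda>j. j - 1" Suc]) (auto simp: divide_inverse)
  \<comment> \<open>\<open>harm k - ln k\<close> is decreasing, so at \<open>M\<close> it is at most
    its value 1 at \<open>k = 1\<close>.\<close>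
  also have "real M * (1 + 2 * harm M) \<le> real M * (3 + 2 * ln (real M))"
    using euler_mascheroni_sequence_decreasing[of 1 M] assms
    by (intro mult_left_mono) (simp_all add: harm_def)
  finally show ?thesis .
qed

text \<open>
  A draw \<^term>\<open>j\<close> whose centre lies in an interval of length at most \<^term>\<open>M div (j + 1)\<close> covers
  it, and about \<^term>\<open>M / l\<close> draws have a window suitable for length \<^term>\<open>l\<close>. So every interval
  contributes about \<^term>\<open>M\<close> to the sum below, independently of its length.
\<close>

lemma sum_coverable_ge:
  fixes J :: "nat set set"
  assumes "finite J" "disjoint J" "\<And>I. I \<in> J \<Longrightarrow> I \<noteq> {} \<and> I \<subseteq> {..<n}"
  shows "card J * M \<le> (\<Sum>j<M. card (\<Union>{I \<in> J. card I \<le> M div (j + 1)})) + n"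
proof -
  have fin: "finite I" if "I \<in> J" for I using assms(3)[OF that] finite_subset by blast
  have card_Union: "card (\<Union>J') = (\<Sum>I\<in>J'. card I)" if "J' \<subseteq> J" for J'
    using that assms(2) fin by (intro card_Union_disjoint) (auto intro: pairwise_subset)
  \<comment> \<open>Draws with \<open>j < M div card I\<close> have a large enough window and
    contribute \<open>card I\<close> each. Rounding loses less than \<open>card I\<close>, and by
    disjointness these losses add up to at most \<open>n\<close>.\<close>
  have "M \<le> (\<Sum>j<M. if card I \<le> M div (j + 1) then card I else 0) + card I" if "I \<in> J" for I
  proof -
    have pos: "card I > 0" using assms(3)[OF that] fin[OF that] by (simp add: card_gt_0_iff)
    have "{..<M div card I} \<subseteq> {j \<in> {..<M}. card I \<le> M div (j + 1)}"
    proof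
      fix j assume "j \<in> {..<M div card I}"
      then have "j + 1 \<le> M div card I" by simp
      then have "(j + 1) * card I \<le> M"
        by (metis less_eq_div_iff_mult_less_eq pos)
      then have "card I \<le> M div (j + 1)"
        by (metis add_gr_0 less_eq_div_iff_mult_less_eq mult.commute zero_less_one)
      moreover have "j < M" using \<open>j + 1 \<le> M div card I\<close> div_le_dividend[of M "card I"] by linarith
      ultimately show "j \<in> {j \<in> {..<M}. card I \<le> M div (j + 1)}" by simp
    qed
    then have "card {..<M div card I} \<le> card {j \<in> {..<M}. card I \<le> M div (j + 1)}"
      by (intro card_mono) auto
    then have "M div card I * card I \<le> card {j \<in> {..<M}. card I \<le> M div (j + 1)} * card I"
      by simp
    also have "\<dots> = (\<Sum>j<M. if card I \<le> M div (j + 1) then card I else 0)"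
      by (simp add: sum.If_cases Int_def)
    finally show ?thesis
      using div_mult_mod_eq[of M "card I"] mod_less_divisor[OF pos, of M] by linarith
  qed
  then have "card J * M \<le> (\<Sum>I\<in>J. (\<Sum>j<M. if card I \<le> M div (j + 1) then card I else 0) + card I)"
    using sum_mono[of J "\<lambda>_. M"] by simp
  also have "\<dots> = (\<Sum>j<M. \<Sum>I\<in>J. if card I \<le> M div (j + 1) then card I else 0) + (\<Sum>I\<in>J. card I)"
    unfolding sum.distrib by (subst sum.swap) simp
  also have "(\<Sum>I\<in>J. card I) = card (\<Union>J)" using card_Union by simp
  also have "\<dots> \<le> n" using card_mono[of "{..<n}" "\<Union>J"] assms(3) by auto
  also have "(\<Sum>j<M. \<Sum>I\<in>J. if card I \<le> M div (j + 1) then card I else 0) =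
      (\<Sum>j<M. card (\<Union>{I \<in> J. card I \<le> M div (j + 1)}))"
    using assms(1) by (intro sum.cong refl, subst card_Union) (auto simp: sum.If_cases Int_def)
  finally show ?thesis by simp
qed

definition draws :: "nat \<Rightarrow> nat \<Rightarrow> (nat \<Rightarrow> nat) pmf" where
  "draws M n = Pi_pmf {..<M} 0 (\<lambda>_. pmf_of_set {..<n})"

text \<open>A draw that hits \<open>G j\<close> covers an interval of \<open>J\<close>. By
  independence, missing every \<open>G j\<close> has a product probability, bounded through
  \<open>1 - x \<le> exp (- x)\<close>; the error \<open>n\<close> of
  \<open>sum_coverable_ge\<close> becomes the 1 in the exponent.\<close>

lemma prob_uncovered_le:
  fixes J :: "nat set set"
  assumes "finite J" "disjoint J" "n > 0"
    and J: "\<And>I. I \<in> J \<Longrightarrow> \<exists>a b. a < b \<and> b \<le> n \<and> I = {a..<b}"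
  shows "measure_pmf.prob (draws M n) {f. \<forall>I\<in>J. \<not> I \<subseteq> set (windows M n f)}
    \<le> exp (1 - real (card J) * real M / real n)"
proof -
  define G where "G j = \<Union>{I \<in> J. card I \<le> M div (j + 1)}" for j
  have J': "I \<noteq> {} \<and> I \<subseteq> {..<n}" if "I \<in> J" for I using J[OF that] by force
  then have G_sub: "G j \<subseteq> {..<n}" for j unfolding G_def by blast
  have "f j \<notin> G j" if "\<forall>I\<in>J. \<not> I \<subseteq> set (windows M n f)" "j < M" for f j
  proof
    assume "f j \<in> G j"
    then obtain I where I: "I \<in> J" "card I \<le> M div (j + 1)" "f j \<in> I" unfolding G_def by blast
    from J[OF I(1)] obtain a b where ab: "a < b" "b \<le> n" "I = {a..<b}" by blast
    have "I \<subseteq> set (windows M n f)"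
    proof
      fix i assume "i \<in> I"
      then have "f j - M div (j + 1) \<le> i" "i \<le> f j + M div (j + 1)" "i < n"
        using I ab by auto
      with \<open>j < M\<close> show "i \<in> set (windows M n f)" unfolding set_windows by blast
    qed
    with that I show False by blast
  qed
  then have "{f. \<forall>I\<in>J. \<not> I \<subseteq> set (windows M n f)} \<subseteq> Pi {..<M} (\<lambda>j. - G j)" by blast
  then have "measure_pmf.prob (draws M n) {f. \<forall>I\<in>J. \<not> I \<subseteq> set (windows M n f)}
      \<le> measure_pmf.prob (draws M n) (Pi {..<M} (\<lambda>j. - G j))"
    by (intro measure_pmf.finite_measure_mono) auto
  also have "\<dots> = (\<Prod>j<M. measure_pmf.prob (pmf_of_set {..<n}) (- G j))"
    unfolding draws_def by (rule measure_Pi_pmf_Pi) simp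
  also have "\<dots> \<le> (\<Prod>j<M. exp (- (real (card (G j)) / real n)))"
  proof (intro prod_mono conjI)
    fix j
    have "measure_pmf.prob (pmf_of_set {..<n}) (- G j) = 1 - measure_pmf.prob (pmf_of_set {..<n}) (G j)"
      using measure_pmf.prob_compl[of "G j" "pmf_of_set {..<n}"] by (simp add: Compl_eq_Diff_UNIV)
    also have "measure_pmf.prob (pmf_of_set {..<n}) (G j) = real (card (G j)) / real n"
      using assms(3) G_sub[of j] by (subst measure_pmf_of_set) (auto simp: Int_absorb1)
    also have "1 - real (card (G j)) / real n \<le> exp (- (real (card (G j)) / real n))"
      using exp_ge_add_one_self[of "- (real (card (G j)) / real n)"] by simp
    finally show "measure_pmf.prob (pmf_of_set {..<n}) (- G j) \<le> exp (- (real (card (G j)) / real n))" .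
  qed simp
  also have "\<dots> = exp (- (real (\<Sum>j<M. card (G j)) / real n))"
    by (simp add: exp_sum[symmetric] sum_negf sum_divide_distrib)
  also have "\<dots> \<le> exp (1 - real (card J) * real M / real n)"
  proof -
    have "card J * M \<le> (\<Sum>j<M. card (G j)) + n"
      unfolding G_def by (rule sum_coverable_ge[OF assms(1,2) J'])
    then have "real (card J) * real M \<le> real (\<Sum>j<M. card (G j)) + real n"
      by (metis of_nat_add of_nat_le_iff of_nat_mult)
    then show ?thesis using assms(3) by (simp add: field_simps)
  qed
  finally show ?thesis .
qed

lemma prob_some_family_uncovered_le:
  assumes "finite F" "n > 0"
    and "\<And>J. J \<in> F \<Longrightarrow> finite J \<and> card J = N \<and> disjoint J"
    and "\<And>J I. J \<in> F \<Longrightarrow> I \<in> J \<Longrightarrow> \<exists>a b. a < b \<and> b \<le> n \<and> I = {a..<b}"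
  shows "measure_pmf.prob (draws M n) {f. \<exists>J\<in>F. \<forall>I\<in>J. \<not> I \<subseteq> set (windows M n f)}
    \<le> real (card F) * exp (1 - real N * real M / real n)"
proof -
  have "{f. \<exists>J\<in>F. \<forall>I\<in>J. \<not> I \<subseteq> set (windows M n f)} =
      (\<Union>J\<in>F. {f. \<forall>I\<in>J. \<not> I \<subseteq> set (windows M n f)})" by auto
  then have "measure_pmf.prob (draws M n) {f. \<exists>J\<in>F. \<forall>I\<in>J. \<not> I \<subseteq> set (windows M n f)} \<le>
      (\<Sum>J\<in>F. measure_pmf.prob (draws M n) {f. \<forall>I\<in>J. \<not> I \<subseteq> set (windows M n f)})"
    using measure_pmf.finite_measure_subadditive_finite[OF assms(1)] by auto
  also have "\<dots> \<le> (\<Sum>J\<in>F. exp (1 - real N * real M / real n))"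
  proof (intro sum_mono)
    fix J assume "J \<in> F"
    with assms(3)[OF this] prob_uncovered_le[of J n M, OF _ _ assms(2) assms(4)]
    show "measure_pmf.prob (draws M n) {f. \<forall>I\<in>J. \<not> I \<subseteq> set (windows M n f)} \<le>
      exp (1 - real N * real M / real n)" by simp
  qed
  finally show ?thesis by simp
qed

section \<open>The tester and its error probability\<close>

definition sampling_tester :: "'a list set \<Rightarrow> real \<Rightarrow> nat \<Rightarrow> 'a rand_alg" where
  "sampling_tester L w M n =
     (if real n < w then return_pmf (ask [0..<n] (consistent L n [0..<n]))
      else map_pmf (\<lambda>f. ask (windows M n f) (consistent L n (windows M n f))) (draws M n))"

lemma set_pmf_sampling_tester:
  assumes "t \<in> set_pmf (sampling_tester L w M n)"
  obtains qs where "t = ask qs (consistent L n qs)" "set qs \<subseteq> {..<n}"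
    "real n < w \<and> qs = [0..<n] \<or> (\<exists>f. qs = windows M n f)"
proof (cases "real n < w")
  case True
  with assms that[of "[0..<n]"] show thesis by (simp add: sampling_tester_def atLeast_upt)
next
  case False
  with assms obtain f where "t = ask (windows M n f) (consistent L n (windows M n f))"
    by (auto simp: sampling_tester_def)
  with that[of "windows M n f"] show thesis by (auto simp: set_windows)
qed

lemma sampling_tester_queries_le:
  assumes "t \<in> set_pmf (sampling_tester L w M n)" "M > 0"
  shows "real (length (queries t u)) \<le> max w (real M * (3 + 2 * ln (real M)))"
  using assms(1) length_windows_le[OF assms(2)]
  by (auto elim!: set_pmf_sampling_tester simp: queries_ask le_max_iff_disj)

lemma mism_eq_hamming_dist:
  "length z = length u \<Longrightarrow> hamming_dist u z = ereal (real (mism u z))"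
  unfolding hamming_dist_def mism_def by (simp add: eq_commute)

context periodic_nfa
begin

text \<open>\<open>D\<close> is the distance paid per blocking interval and also bounds the number
  of families. Words shorter than \<open>8 * D / \<epsilon>\<close> are read entirely; for longer
  ones \<open>M\<close> makes each family uncovered with probability at most
  \<open>1 / (3 * D)\<close>, and a union bound gives \<open>1 / 3\<close>.\<close>

lemma is_tester_sampling_tester:
  fixes \<epsilon> :: real
  defines "D \<equiv> real ((B + 1) * (card (states A) * m + 1))"
  assumes \<epsilon>: "0 < \<epsilon>" "\<epsilon> < 1"
    and M: "real M \<ge> 2 * D * (1 + ln (3 * D)) / \<epsilon>"
  shows "is_tester \<epsilon> \<Sigma> (nfa_lang A) (sampling_tester (nfa_lang A) (8 * D / \<epsilon>) M)"
  unfolding is_tester_def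
proof (intro ballI conjI impI)
  let ?L = "nfa_lang A" let ?T = "sampling_tester ?L (8 * D / \<epsilon>) M"
  fix u :: "'a list"
  show "set (queries t u) \<subseteq> {..<length u}" if "t \<in> set_pmf (?T (length u))" for t
    using that by (auto elim!: set_pmf_sampling_tester simp: queries_ask)
  show "accepts t u" if "u \<in> ?L" "t \<in> set_pmf (?T (length u))" for t
    using that by (auto elim!: set_pmf_sampling_tester simp: accepts_ask consistent_def)
  assume u: "u \<notin> ?L \<and> far_from \<epsilon> ?L u"
  let ?n = "length u"
  show "2 / 3 \<le> measure_pmf.prob (?T ?n) {t. \<not> accepts t u}"
  proof (cases "real ?n < 8 * D / \<epsilon>")
    case True
    have "z = u" if "length z = ?n" "map ((!) z) [0..<?n] = map ((!) u) [0..<?n]" for z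
      using that by (intro nth_equalityI) auto
    then have "\<not> consistent ?L ?n [0..<?n] (map ((!) u) [0..<?n])"
      using u unfolding consistent_def by metis
    with True show ?thesis by (simp add: sampling_tester_def accepts_ask)
  next
    case False
    have "D \<ge> B + 1" "D \<ge> 1"
      unfolding D_def by (simp_all add: algebra_simps)
    have large: "8 \<le> \<epsilon> * ?n / D"
      using False \<epsilon> \<open>D \<ge> 1\<close> by (simp add: field_simps)
    have "8 * D \<le> \<epsilon> * ?n" using large \<open>D \<ge> 1\<close> by (simp add: field_simps)
    also have "\<dots> \<le> ?n" using \<epsilon> by (simp add: mult_left_le_one_le)
    finally have "B \<le> ?n" "?n > 0" using \<open>D \<ge> B + 1\<close> by linarith+
    \<comment> \<open>The offset 3 leaves \<open>2 * D > B\<close> in reserve beyond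
      \<open>(N + 1) * D\<close>, while \<open>large\<close> still ensures that \<open>N\<close> is
      at least \<open>\<epsilon> * ?n / (2 * D)\<close>.\<close>
    define N where "N = nat \<lfloor>\<epsilon> * ?n / D\<rfloor> - 3"
    have N: "real N + 3 \<le> \<epsilon> * ?n / D" "real N > \<epsilon> * ?n / D - 4"
      using large unfolding N_def by linarith+
    have far: "mism u z > (N + 1) * (B + 1) * (card (states A) * m + 1) + B"
      if "z \<in> ?L" "length z = ?n" for z
    proof -
      have "(real N + 3) * D \<le> \<epsilon> * ?n" using N(1) \<open>D \<ge> 1\<close> by (simp add: field_simps)
      also have "\<dots> \<le> mism u z"
        using u that mism_eq_hamming_dist[of z u] unfolding far_from_def by force
      finally have "(real N + 1) * D + 2 * D \<le> mism u z" by (simp add: algebra_simps)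
      then have "(real N + 1) * D + B < mism u z" using \<open>D \<ge> B + 1\<close> by linarith
      then have "real ((N + 1) * (B + 1) * (card (states A) * m + 1) + B) < mism u z"
        unfolding D_def by (simp add: algebra_simps)
      then show ?thesis by (simp only: of_nat_less_iff)
    qed
    obtain F where F: "finite F" "card F \<le> card (states A) * m"
      "\<And>J. J \<in> F \<Longrightarrow> finite J \<and> card J = N \<and> disjoint J"
      "\<And>J I. J \<in> F \<Longrightarrow> I \<in> J \<Longrightarrow> \<exists>a b. a < b \<and> b \<le> ?n \<and> I = {a..<b}"
      "\<And>z. z \<in> ?L \<Longrightarrow> length z = ?n \<Longrightarrow> \<exists>J\<in>F. \<forall>I\<in>J. \<exists>i\<in>I. z ! i \<noteq> u ! i"
      using blocking_families[OF \<open>B \<le> ?n\<close> far] by blast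
    let ?X = "{f. \<exists>J\<in>F. \<forall>I\<in>J. \<not> I \<subseteq> set (windows M ?n f)}"
    have "measure_pmf.prob (draws M ?n) ?X \<le> real (card F) * exp (1 - real N * real M / ?n)"
      by (rule prob_some_family_uncovered_le[OF F(1) \<open>?n > 0\<close> F(3,4)])
    also have "\<dots> \<le> D * exp (- ln (3 * D))"
    proof (intro mult_mono)
      have "card F \<le> 1 * (card (states A) * m + 1)" using F(2) by simp
      also have "\<dots> \<le> (B + 1) * (card (states A) * m + 1)" by (intro mult_le_mono) auto
      finally show "real (card F) \<le> D" unfolding D_def by (rule of_nat_mono)
      have "1 + ln (3 * D) = \<epsilon> * ?n / (2 * D) * (2 * D * (1 + ln (3 * D)) / \<epsilon>) / ?n"
        using \<epsilon> \<open>D \<ge> 1\<close> \<open>?n > 0\<close> by (simp add: field_simps)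
      also have "\<dots> \<le> real N * real M / ?n"
      proof (intro divide_right_mono mult_mono M)
        have "\<epsilon> * ?n / (2 * D) = (\<epsilon> * ?n / D) / 2" by simp
        then show "\<epsilon> * ?n / (2 * D) \<le> real N" using N(2) large by linarith
      qed (use \<epsilon> \<open>D \<ge> 1\<close> in auto)
      finally show "exp (1 - real N * real M / ?n) \<le> exp (- ln (3 * D))" by simp
    qed (use \<open>D \<ge> 1\<close> in auto)
    also have "\<dots> = 1 / 3" using \<open>D \<ge> 1\<close> by (simp add: exp_minus field_simps)
    finally have "2 / 3 \<le> 1 - measure_pmf.prob (draws M ?n) ?X" by simp
    also have "\<dots> = measure_pmf.prob (draws M ?n) (- ?X)"
      using measure_pmf.prob_compl[of ?X "draws M ?n"] by (simp add: Compl_eq_Diff_UNIV)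
    also have "\<dots> \<le> measure_pmf.prob (draws M ?n)
        {f. \<not> accepts (ask (windows M ?n f) (consistent ?L ?n (windows M ?n f))) u}"
    proof (intro measure_pmf.finite_measure_mono subsetI)
      fix f assume "f \<in> - ?X"
      then have cov: "\<exists>I\<in>J. I \<subseteq> set (windows M ?n f)" if "J \<in> F" for J using that by blast
      \<comment> \<open>Every family has a fully queried interval, whereas each accepted word of
        this length differs from \<open>u\<close> on all intervals of some family.\<close>
      have "\<not> consistent ?L ?n (windows M ?n f) (map ((!) u) (windows M ?n f))"
      proof
        assume "consistent ?L ?n (windows M ?n f) (map ((!) u) (windows M ?n f))"
        then obtain z where z: "z \<in> ?L" "length z = ?n" "\<forall>i\<in>set (windows M ?n f). z ! i = u ! i"
          unfolding consistent_def by auto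
        from F(5)[OF z(1,2)] obtain J where J: "J \<in> F" "\<forall>I\<in>J. \<exists>i\<in>I. z ! i \<noteq> u ! i" by blast
        with cov[OF J(1)] z(3) show False by blast
      qed
      then show "f \<in> {f. \<not> accepts (ask (windows M ?n f) (consistent ?L ?n (windows M ?n f))) u}"
        by (simp add: accepts_ask)
    qed simp
    also have "\<dots> = measure_pmf.prob (?T ?n) {t. \<not> accepts t u}"
      using False by (simp add: sampling_tester_def vimage_def)
    finally show ?thesis .
  qed
qed

end

section \<open>Choice of constants\<close>

lemma periodic_nfa_exists:
  assumes "is_nfa A"
  obtains m B where "periodic_nfa A m B"
proof -
  obtain m b where mb: "m > 0" "\<And>k. k \<ge> b \<Longrightarrow> step A ^^ (k + m) = step A ^^ k"
    using relpow_eventually_periodic[OF finite_step[OF assms]] by blast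
  have "periodic_nfa A m (max b (card (states A)))"
    using assms mb by unfold_locales auto
  with that show thesis by blast
qed

theorem theorem47:
  fixes A :: "('q, 'a) nfa"
  assumes "is_nfa A"
  shows "\<exists>C > 0. \<exists>\<epsilon>\<^sub>0 > 0. \<forall>\<epsilon>::real. 0 < \<epsilon> \<and> \<epsilon> < \<epsilon>\<^sub>0 \<longrightarrow>
           (\<exists>T. is_tester \<epsilon> (alphabet A) (nfa_lang A) T \<and>
                query_bound (alphabet A) T (C * ((1 / \<epsilon>) * ln (1 / \<epsilon>))))"
proof -
  obtain m B where "periodic_nfa A m B" using periodic_nfa_exists[OF assms] .
  then interpret periodic_nfa A m B .
  define D where "D = real ((B + 1) * (card (states A) * m + 1))"
  \<comment> \<open>The summand 1 pays for rounding \<open>M\<close> up: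
    \<open>M \<le> G / \<epsilon>\<close> because \<open>\<epsilon> < 1\<close>.\<close>
  define G where "G = 2 * D * (1 + ln (3 * D)) + 1"
  \<comment> \<open>The arguments of \<open>max\<close> account for short words and for windows; the
    latter uses that \<open>3 + 2 * ln M\<close> is at most
    \<open>(5 + 2 * ln G) * ln (1 / \<epsilon>)\<close>.\<close>
  define C where "C = max (8 * D) (G * (5 + 2 * ln G))"
  have D: "D \<ge> 1" unfolding D_def by (simp add: algebra_simps)
  then have "ln (3 * D) \<ge> 0" by simp
  with D have G: "G \<ge> 1" unfolding G_def by simp
  have "C > 0" unfolding C_def using D by simp
  \<comment> \<open>Below \<open>exp (- 1)\<close> the factor \<open>ln (1 / \<epsilon>)\<close> is
    at least 1 and absorbs additive constants.\<close>
  moreover have "\<exists>T. is_tester \<epsilon> (alphabet A) (nfa_lang A) T \<and>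
      query_bound (alphabet A) T (C * ((1 / \<epsilon>) * ln (1 / \<epsilon>)))"
    if \<epsilon>: "0 < \<epsilon>" "\<epsilon> < exp (- 1)" for \<epsilon> :: real
  proof (intro exI conjI)
    define M where "M = nat \<lceil>2 * D * (1 + ln (3 * D)) / \<epsilon>\<rceil>"
    have "exp (- 1 :: real) < 1" by simp
    with \<epsilon> have \<epsilon>1: "\<epsilon> < 1" by linarith
    have x_pos: "2 * D * (1 + ln (3 * D)) / \<epsilon> > 0"
      using D \<open>ln (3 * D) \<ge> 0\<close> \<epsilon> by (intro divide_pos_pos mult_pos_pos add_pos_nonneg) auto
    then have M: "real M \<ge> 2 * D * (1 + ln (3 * D)) / \<epsilon>" "M > 0"
      unfolding M_def by linarith+
    have "real M \<le> 2 * D * (1 + ln (3 * D)) / \<epsilon> + 1"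
      using x_pos unfolding M_def by linarith
    also have "\<dots> \<le> G / \<epsilon>" using \<epsilon> \<epsilon>1 unfolding G_def by (simp add: add_divide_distrib)
    finally have M_le: "real M \<le> G / \<epsilon>" .
    have "ln (exp 1) \<le> ln (1 / \<epsilon>)"
      using \<epsilon> by (subst ln_le_cancel_iff) (auto simp: exp_minus field_simps)
    then have ln1: "1 \<le> ln (1 / \<epsilon>)" by simp
    show "is_tester \<epsilon> (alphabet A) (nfa_lang A) (sampling_tester (nfa_lang A) (8 * D / \<epsilon>) M)"
      unfolding D_def by (rule is_tester_sampling_tester) (use \<epsilon> \<epsilon>1 M(1) in \<open>auto simp: D_def\<close>)
    have "8 * D / \<epsilon> \<le> C * ((1 / \<epsilon>) * ln (1 / \<epsilon>))"
    proof -
      have "8 * D * (1 / \<epsilon>) * 1 \<le> C * (1 / \<epsilon>) * ln (1 / \<epsilon>)"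
        using \<epsilon> ln1 D by (intro mult_mono) (auto simp: C_def)
      then show ?thesis by (simp add: mult.assoc)
    qed
    moreover have "real M * (3 + 2 * ln (real M)) \<le> C * ((1 / \<epsilon>) * ln (1 / \<epsilon>))"
    proof -
      have "ln (real M) \<le> ln (G / \<epsilon>)" using M_le M(2) G \<epsilon> by (subst ln_le_cancel_iff) auto
      also have "\<dots> = ln G + ln (1 / \<epsilon>)" using G \<epsilon> by (simp add: ln_div)
      finally have "3 + 2 * ln (real M) \<le> (3 + 2 * ln G) * 1 + 2 * ln (1 / \<epsilon>)" by simp
      also have "\<dots> \<le> (3 + 2 * ln G) * ln (1 / \<epsilon>) + 2 * ln (1 / \<epsilon>)"
        using G ln1 by (intro add_right_mono mult_left_mono) auto
      finally have *: "3 + 2 * ln (real M) \<le> (5 + 2 * ln G) * ln (1 / \<epsilon>)"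
        by (simp add: algebra_simps)
      have "real M * (3 + 2 * ln (real M)) \<le> (G / \<epsilon>) * ((5 + 2 * ln G) * ln (1 / \<epsilon>))"
        using M_le * G \<epsilon> M(2) by (intro mult_mono) auto
      also have "\<dots> = (G * (5 + 2 * ln G)) * ((1 / \<epsilon>) * ln (1 / \<epsilon>))" by simp
      also have "\<dots> \<le> C * ((1 / \<epsilon>) * ln (1 / \<epsilon>))"
        using \<epsilon> ln1 by (intro mult_right_mono) (use \<epsilon>1 in \<open>auto simp: C_def zero_le_divide_iff\<close>)
      finally show ?thesis .
    qed
    ultimately show "query_bound (alphabet A) (sampling_tester (nfa_lang A) (8 * D / \<epsilon>) M)
        (C * ((1 / \<epsilon>) * ln (1 / \<epsilon>)))"
      unfolding query_bound_def
      using sampling_tester_queries_le[OF _ M(2)] by (meson max.boundedI order.trans)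
  qed
  ultimately show ?thesis by (metis exp_gt_zero)
qed

end
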